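(* Let $A_j$, $A$, $\gamma>0$, $M_\gamma$, $\sigma_\gamma$, and the iterates $q_\gamma^k$, $\tilde q_\gamma^k$ be as follows: $A_j\in\mathbb{C}^{r_j\times n}$, $A=\begin{bmatrix}A_1\\ \vdots\\ A_m\end{bmatrix}$ of full row rank, $D_\gamma=\operatorname{diag}(\gamma I+A_jA_j^* )_{j}$, $L$ strictly block lower triangular with $(i,j)$ block $A_iA_j^*$ ($i>j$), $M_\gamma=(D_\gamma+L)^{-1}$, $R_\gamma=(D_{2\gamma})^{1/2}M_\gamma A$, $\sigma_\gamma$ the smallest nonzero singular value of $R_\gamma$, and $q_\gamma^k$ (resp. $\tilde q_\gamma^k$) the iterates starting at $0$ of $q^{k+1}=(I-A^*M_\gamma A)q^k+A^*M_\gamma p$ with exact data $p$ (resp. with data $\tilde p=\tilde p^{(N)}$). Suppose that, for a sequence of perturbed data $\tilde p^{(N)}$ indexed by the number $N$ of realizations, $\sqrt N(\tilde p^{(N)}-p)$ converges in distribution to a centered Gaussian $\mathcal N(0,\Theta)$ with covariance $\Theta$ (in the paper $\Theta=AHA^*+\delta^2 I$, with $H$ a diagonal nonnegative matrix and $\delta\ge 0$ the noise level). Then for each fixed $k\ge1$, $e^k=\tilde q_\gamma^k-q_\gamma^k$ satisfies $\sqrt N e^k\xrightarrow{d}\mathcal N(0,\Lambda_k)$ for a covariance matrix $\Lambda_k$ with $$\|\Lambda_k\|\le\left[\frac{1-(1-\sigma_\gamma^2)^{k/2}}{1-(1-\sigma_\gamma^2)^{1/2}}\right]^2\|A^*M_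\gamma\|^2\,\|\Theta\|.$$
   Context: $A^*$ is the conjugate transpose, $D_{2\gamma}$ is $D_\gamma$ with $\gamma$ replaced by $2\gamma$, $(D_{2\gamma})^{1/2}$ its Hermitian positive definite square root; $\|\cdot\|$ is the operator 2-norm; $\xrightarrow{d}$ denotes convergence in distribution. *)

theory Defs
  imports "HOL-Analysis.Analysis" "HOL-Probability.Probability"
begin

section \<open>Complex matrix notions\<close>

text \<open>Conjugate transpose.\<close>
definition cadj :: "complex^'n^'m \<Rightarrow> complex^'m^'n" where
  "cadj A = (\<chi> i j. cnj (A $ j $ i))"

definition cinner :: "complex^'n \<Rightarrow> complex^'n \<Rightarrow> complex" where
  "cinner x y = (\<Sum>i\<in>UNIV. cnj (x $ i) * y $ i)"

definition hermitian_mat :: "complex^'n^'n \<Rightarrow> bool" where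
  "hermitian_mat S \<longleftrightarrow> cadj S = S"

definition hpd_mat :: "complex^'n^'n \<Rightarrow> bool" where
  "hpd_mat S \<longleftrightarrow> hermitian_mat S \<and> (\<forall>x. x \<noteq> 0 \<longrightarrow> 0 < Re (cinner x (S *v x)))"

text \<open>Hermitian positive definite square root.\<close>
definition hpd_sqrt :: "complex^'n^'n \<Rightarrow> complex^'n^'n" where
  "hpd_sqrt D = (THE S. hpd_mat S \<and> S ** S = D)"

text \<open>Operator 2-norm (Euclidean norm on complex vectors).\<close>
definition cmat_norm :: "complex^'n^'m \<Rightarrow> real" where
  "cmat_norm B = onorm (\<lambda>x. B *v x)"

text \<open>Singular values of R: the s \<ge> 0 with s^2 an eigenvalue of R^* R;
  smallest nonzero singular value.\<close>
definition singular_values :: "complex^'n^'m \<Rightarrow> real set" where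
  "singular_values R = {s. 0 \<le> s \<and> (\<exists>v. v \<noteq> 0 \<and> (cadj R ** R) *v v = complex_of_real (s^2) *s v)}"

definition min_nonzero_sv :: "complex^'n^'m \<Rightarrow> real" where
  "min_nonzero_sv R = Inf (singular_values R - {0})"

section \<open>The block iteration\<close>

text \<open>Rows of A are grouped into blocks: row i belongs to block blk i; blocks are
  ordered by their index (block A_j has index j).\<close>

definition Dgam :: "('r \<Rightarrow> nat) \<Rightarrow> complex^'n^'r \<Rightarrow> real \<Rightarrow> complex^'r^'r" where
  "Dgam blk A \<gamma> = (\<chi> i j. if blk i = blk j
      then (A ** cadj A) $ i $ j + (if i = j then complex_of_real \<gamma> else 0) else 0)"

definition Lblk :: "('r \<Rightarrow> nat) \<Rightarrow> complex^'n^'r \<Rightarrow> complex^'r^'r" where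
  "Lblk blk A = (\<chi> i j. if blk j < blk i then (A ** cadj A) $ i $ j else 0)"

definition Mgam :: "('r \<Rightarrow> nat) \<Rightarrow> complex^'n^'r \<Rightarrow> real \<Rightarrow> complex^'r^'r" where
  "Mgam blk A \<gamma> = matrix_inv (Dgam blk A \<gamma> + Lblk blk A)"

definition Rgam :: "('r \<Rightarrow> nat) \<Rightarrow> complex^'n^'r \<Rightarrow> real \<Rightarrow> complex^'n^'r" where
  "Rgam blk A \<gamma> = hpd_sqrt (Dgam blk A (2 * \<gamma>)) ** Mgam blk A \<gamma> ** A"

definition sigma_gam :: "('r \<Rightarrow> nat) \<Rightarrow> complex^'n^'r \<Rightarrow> real \<Rightarrow> real" where
  "sigma_gam blk A \<gamma> = min_nonzero_sv (Rgam blk A \<gamma>)"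

text \<open>q^0 = 0, q^{k+1} = (I - A^* M A) q^k + A^* M p.\<close>
primrec qiter :: "complex^'n^'r \<Rightarrow> complex^'r^'r \<Rightarrow> complex^'r \<Rightarrow> nat \<Rightarrow> complex^'n" where
  "qiter A M p 0 = 0"
| "qiter A M p (Suc k) = (mat 1 - cadj A ** M ** A) *v qiter A M p k + (cadj A ** M) *v p"

section \<open>Probability\<close>

text \<open>Convergence in distribution of random vectors X N (defined on probability
  spaces P N) to the probability law mu: E f(X_N) \<rightarrow> \<integral> f d\<mu> for all bounded continuous f.\<close>
definition conv_in_distr ::
  "(nat \<Rightarrow> 'a measure) \<Rightarrow> (nat \<Rightarrow> 'a \<Rightarrow> 'v::topological_space) \<Rightarrow> 'v measure \<Rightarrow> bool" where
  "conv_in_distr P X \<mu> \<longleftrightarrow>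
     (\<forall>N. prob_space (P N) \<and> X N \<in> borel_measurable (P N)) \<and>
     prob_space \<mu> \<and> sets \<mu> = sets borel \<and>
     (\<forall>f :: 'v \<Rightarrow> real. continuous_on UNIV f \<longrightarrow> bounded (range f) \<longrightarrow>
        (\<lambda>N. \<integral>x. f (X N x) \<partial>P N) \<longlonglongrightarrow> (\<integral>x. f x \<partial>\<mu>))"

text \<open>Centered real normal law of variance v (degenerate point mass if v = 0).\<close>
definition centered_normal :: "real \<Rightarrow> real measure" where
  "centered_normal v = (if v = 0 then return borel 0 else density lborel (normal_density 0 (sqrt v)))"

text \<open>Centered Gaussian law on C^r with covariance Theta = E[x x^*]: every real-linear
  functional of x is centered normal, and the second moments are given by Theta.\<close>
definition centered_gaussian :: "(complex^'r) measure \<Rightarrow> complex^'r^'r \<Rightarrow> bool" where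
  "centered_gaussian \<mu> \<Theta> \<longleftrightarrow>
     prob_space \<mu> \<and> sets \<mu> = sets borel \<and>
     (\<forall>l :: complex^'r \<Rightarrow> real. linear l \<longrightarrow>
        (\<exists>v\<ge>0. distr \<mu> borel l = centered_normal v)) \<and>
     (\<forall>i j. integrable \<mu> (\<lambda>x. x $ i * cnj (x $ j)) \<and>
            (\<integral>x. x $ i * cnj (x $ j) \<partial>\<mu>) = \<Theta> $ i $ j)"

end

theory Submission
  imports Defs
begin

text \<open>Let \<open>K = D\<^sub>\<gamma> + L\<close>, so that \<open>M\<^sub>\<gamma> = K\<^sup>-\<^sup>1\<close> and \<open>K + K\<^sup>* = D\<^sub>2\<^sub>\<gamma> + A A\<^sup>*\<close>. Expanding norms
  with this identity gives \<open>\<parallel>T x\<parallel>\<^sup>2 + \<parallel>R\<^sub>\<gamma> x\<parallel>\<^sup>2 = \<parallel>x\<parallel>\<^sup>2\<close> for \<open>T = I - A\<^sup>* M\<^sub>\<gamma> A\<close>. Since \<open>R\<^sub>\<gamma>\<close>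
  and \<open>A\<close> have the same kernel, every \<open>x\<close> in the range of \<open>A\<^sup>*\<close>, which contains all iterates and
  is \<open>T\<close>-invariant, satisfies \<open>\<parallel>R\<^sub>\<gamma> x\<parallel> \<ge> \<sigma>\<^sub>\<gamma> \<parallel>x\<parallel>\<close>, hence \<open>\<parallel>T x\<parallel> \<le> (1 - \<sigma>\<^sub>\<gamma>\<^sup>2)\<^sup>1\<^sup>/\<^sup>2 \<parallel>x\<parallel>\<close>.
  The error is linear in the data, \<open>e\<^sup>k = B\<^sub>k (p' - p)\<close> for the perturbed data \<open>p'\<close>, where
  \<open>B\<^sub>k = \<Sum>\<^sub>j\<^sub><\<^sub>k T\<^sup>j A\<^sup>* M\<^sub>\<gamma>\<close> is bounded by a geometric series; and a fixed matrix \<open>B\<close> maps the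
  Gaussian limit with covariance \<open>\<Theta>\<close> to the Gaussian limit with covariance \<open>B \<Theta> B\<^sup>*\<close>.\<close>

section \<open>The complex inner product\<close>

lemma cadj_nth [simp]: "cadj A $ i $ j = cnj (A $ j $ i)"
  by (simp add: cadj_def)

lemma cadj_cadj [simp]: "cadj (cadj A) = A"
  by (simp add: vec_eq_iff)

lemma cadj_matrix_mult: "cadj (A ** B) = cadj B ** cadj A"
  by (simp add: vec_eq_iff matrix_matrix_mult_def mult.commute)

lemma cinner_cadj_left: "cinner (cadj A *v x) y = cinner x (A *v y)"
proof -
  have "cinner x (A *v y) = (\<Sum>i\<in>UNIV. \<Sum>j\<in>UNIV. cnj (x$i) * A$i$j * y$j)"
    unfolding cinner_def matrix_vector_mult_def by (simp add: sum_distrib_left mult.assoc)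
  also have "\<dots> = (\<Sum>j\<in>UNIV. \<Sum>i\<in>UNIV. cnj (x$i) * A$i$j * y$j)"
    by (rule sum.swap)
  also have "\<dots> = cinner (cadj A *v x) y"
    unfolding cinner_def matrix_vector_mult_def by (simp add: sum_distrib_left mult_ac)
  finally show ?thesis ..
qed

lemma cinner_commute: "cinner y x = cnj (cinner x y)"
  by (simp add: cinner_def mult.commute)

lemma cinner_add_right: "cinner x (y + z) = cinner x y + cinner x z"
  by (simp add: cinner_def distrib_left sum.distrib)

lemma cinner_add_left: "cinner (x + y) z = cinner x z + cinner y z"
  by (simp add: cinner_def distrib_right sum.distrib)

lemma cinner_diff_right: "cinner x (y - z) = cinner x y - cinner x z"
  by (simp add: cinner_def right_diff_distrib sum_subtractf)

lemma cinner_diff_left: "cinner (x - y) z = cinner x z - cinner y z"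
  by (simp add: cinner_def left_diff_distrib sum_subtractf)

lemma cinner_scale_right: "cinner x (c *s y) = c * cinner x y"
  by (simp add: cinner_def sum_distrib_left mult_ac)

lemma cinner_scale_left: "cinner (c *s x) y = cnj c * cinner x y"
  by (simp add: cinner_def sum_distrib_left mult_ac)

lemma cinner_zero_right [simp]: "cinner x 0 = 0"
  by (simp add: cinner_def)

lemma cinner_zero_left [simp]: "cinner 0 x = 0"
  by (simp add: cinner_def)

lemma cinner_sum_right: "finite S \<Longrightarrow> cinner x (\<Sum>u\<in>S. f u) = (\<Sum>u\<in>S. cinner x (f u))"
  by (induction S rule: finite_induct) (auto simp: cinner_add_right)

lemma Re_cinner: "Re (cinner x y) = x \<bullet> y"
  by (simp add: cinner_def inner_vec_def inner_complex_def)

lemma cinner_self: "cinner x x = complex_of_real ((norm x)\<^sup>2)"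
proof -
  have "cinner x x = (\<Sum>i\<in>UNIV. complex_of_real ((cmod (x $ i))\<^sup>2))"
    unfolding cinner_def
    by (intro sum.cong refl) (metis complex_norm_square mult.commute of_real_power)
  also have "\<dots> = complex_of_real (\<Sum>i\<in>UNIV. (cmod (x $ i))\<^sup>2)"
    by simp
  also have "(\<Sum>i\<in>UNIV. (cmod (x $ i))\<^sup>2) = (norm x)\<^sup>2"
    by (simp add: norm_vec_def L2_set_def sum_nonneg)
  finally show ?thesis .
qed

lemma Re_cinner_self: "Re (cinner x x) = (norm x)\<^sup>2"
  by (simp add: cinner_self)

lemma cinner_cadj_self: "cinner x ((A ** cadj A) *v x) = complex_of_real ((norm (cadj A *v x))\<^sup>2)"
  by (simp add: matrix_vector_mul_assoc[symmetric] cinner_cadj_left[symmetric] cinner_self)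

lemma matrix_vector_mult_scale: "(A::complex^'n^'m) *v (c *s x) = c *s (A *v x)"
  by (simp add: vec_eq_iff matrix_vector_mult_def sum_distrib_left mult_ac)

lemma cmatrix_vector_mult_scaleR: "(A::complex^'n^'m) *v (c *\<^sub>R x) = c *\<^sub>R (A *v x)"
  using linear_iff matrix_vector_mul_linear by blast

lemma matrix_vector_mult_sum:
  "finite S \<Longrightarrow> A *v (\<Sum>u\<in>S. f u) = (\<Sum>u\<in>S. A *v f u)"
  by (induction S rule: finite_induct) (auto simp: matrix_vector_right_distrib)

lemma mat_matrix_vector_mult: "mat c *v x = c *s x"
  by (simp add: vec_eq_iff matrix_vector_mult_def mat_def if_distrib if_distribR cong: if_cong)

lemma norm_vector_scale: "norm ((c::complex) *s (x::complex^'n)) = cmod c * norm x"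
proof -
  have "(norm (c *s x))\<^sup>2 = Re ((cnj c * c) * cinner x x)"
    by (simp only: Re_cinner_self[symmetric] cinner_scale_left cinner_scale_right mult_ac)
  also have "\<dots> = (cmod c * norm x)\<^sup>2"
    by (simp add: cinner_self power_mult_distrib complex_norm_square[symmetric] mult.commute)
  finally show ?thesis
    by (simp add: power2_eq_iff_nonneg)
qed

lemma continuous_on_cinner [continuous_intros]:
  "continuous_on S f \<Longrightarrow> continuous_on S g \<Longrightarrow> continuous_on S (\<lambda>x. cinner (f x) (g x))"
  unfolding cinner_def by (intro continuous_intros)

lemma hermitian_cinner: "hermitian_mat H \<Longrightarrow> cinner x (H *v y) = cinner (H *v x) y"
  by (simp add: hermitian_mat_def cinner_cadj_left[symmetric])

lemma hermitian_cinner_real: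
  assumes "hermitian_mat H"
  shows "cinner x (H *v x) = complex_of_real (Re (cinner x (H *v x)))"
proof -
  have "cinner x (H *v x) = cnj (cinner x (H *v x))"
    using hermitian_cinner[OF assms, of x x] cinner_commute[of "H *v x" x] by simp
  then show ?thesis
    by (metis Reals_cnj_iff of_real_Re)
qed

section \<open>Operator norm\<close>

lemma cmat_norm_bound: "norm (A *v x) \<le> cmat_norm A * norm x"
  unfolding cmat_norm_def using onorm[OF matrix_vector_mul_bounded_linear] .

lemma cmat_norm_nonneg: "0 \<le> cmat_norm A"
  unfolding cmat_norm_def using onorm_pos_le[OF matrix_vector_mul_bounded_linear] .

lemma cmat_norm_le: "0 \<le> b \<Longrightarrow> (\<And>x. norm (A *v x) \<le> b * norm x) \<Longrightarrow> cmat_norm A \<le> b"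
  unfolding cmat_norm_def by (rule onorm_bound)

lemma cmat_norm_matrix_mult: "cmat_norm (A ** B) \<le> cmat_norm A * cmat_norm B"
proof (rule cmat_norm_le)
  show "0 \<le> cmat_norm A * cmat_norm B"
    by (simp add: cmat_norm_nonneg)
next
  fix x
  have "norm ((A ** B) *v x) \<le> cmat_norm A * norm (B *v x)"
    by (simp add: matrix_vector_mul_assoc[symmetric] cmat_norm_bound)
  also have "\<dots> \<le> cmat_norm A * (cmat_norm B * norm x)"
    by (intro mult_left_mono cmat_norm_bound cmat_norm_nonneg)
  finally show "norm ((A ** B) *v x) \<le> cmat_norm A * cmat_norm B * norm x"
    by (simp add: mult_ac)
qed

lemma cmat_norm_cadj: "cmat_norm (cadj A) \<le> cmat_norm A"
proof (rule cmat_norm_le[OF cmat_norm_nonneg])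
  fix x
  let ?y = "cadj A *v x"
  have "(norm ?y)\<^sup>2 = x \<bullet> (A *v ?y)"
    using arg_cong[where f = Re, OF cinner_cadj_left[of A x ?y]]
    by (simp add: cinner_self Re_cinner)
  also have "\<dots> \<le> norm x * (cmat_norm A * norm ?y)"
    by (intro order.trans[OF norm_cauchy_schwarz] mult_left_mono cmat_norm_bound) simp
  finally have "norm ?y * norm ?y \<le> (cmat_norm A * norm x) * norm ?y"
    by (simp add: power2_eq_square mult_ac)
  then show "norm ?y \<le> cmat_norm A * norm x"
    by (cases "norm ?y = 0") (auto simp: cmat_norm_nonneg)
qed

lemma cmat_norm_zero [simp]: "cmat_norm (0::complex^'n^'m) = 0"
  using cmat_norm_le[of 0 "0::complex^'n^'m"] cmat_norm_nonneg[of "0::complex^'n^'m"] by simp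

section \<open>Spectral theorem for Hermitian matrices\<close>

definition cortho_basis :: "(complex^'n) set \<Rightarrow> bool" where
  "cortho_basis B \<longleftrightarrow> finite B \<and> (\<forall>u\<in>B. cinner u u = 1) \<and>
     (\<forall>u\<in>B. \<forall>v\<in>B. u \<noteq> v \<longrightarrow> cinner u v = 0) \<and> (\<forall>x. (\<Sum>u\<in>B. cinner u x *s u) = x)"

lemma cortho_basis_expansion: "cortho_basis B \<Longrightarrow> (\<Sum>u\<in>B. cinner u x *s u) = x"
  by (simp add: cortho_basis_def)

lemma cortho_basis_nonzero: "cortho_basis B \<Longrightarrow> u \<in> B \<Longrightarrow> u \<noteq> 0"
  by (auto simp: cortho_basis_def)

lemma cortho_basis_norm: "cortho_basis B \<Longrightarrow> u \<in> B \<Longrightarrow> norm u = 1"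
  using Re_cinner_self[of u] power2_eq_iff_nonneg[of "norm u" 1] by (simp add: cortho_basis_def)

lemma cortho_basis_cinner_nonzero:
  assumes "cortho_basis B" "x \<noteq> 0"
  obtains u where "u \<in> B" "cinner u x \<noteq> 0"
proof -
  have "(\<Sum>u\<in>B. cinner u x *s u) \<noteq> 0"
    using cortho_basis_expansion[OF assms(1), of x] assms(2) by simp
  then obtain u where "u \<in> B" "cinner u x *s u \<noteq> 0"
    by (meson sum.neutral)
  then show ?thesis
    using that by auto
qed

lemma cortho_basis_matrix_vector_mult:
  fixes C :: "complex^'n^'m"
  assumes "cortho_basis B"
  shows "C *v x = (\<Sum>u\<in>B. cinner u x *s (C *v u))"
proof -
  have "finite B"
    using assms by (simp add: cortho_basis_def)
  have "C *v x = C *v (\<Sum>u\<in>B. cinner u x *s u)"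
    by (simp only: cortho_basis_expansion[OF assms])
  also have "\<dots> = (\<Sum>u\<in>B. cinner u x *s (C *v u))"
    by (simp add: matrix_vector_mult_sum[OF \<open>finite B\<close>] matrix_vector_mult_scale)
  finally show ?thesis .
qed

lemma cortho_basis_matrix_eqI:
  assumes "cortho_basis B" and "\<And>u. u \<in> B \<Longrightarrow> M *v u = N *v u"
  shows "M = N"
proof -
  have "M *v x = N *v x" for x
    using cortho_basis_matrix_vector_mult[OF assms(1), of M x]
      cortho_basis_matrix_vector_mult[OF assms(1), of N x] assms(2) by simp
  then show ?thesis
    by (simp add: matrix_eq)
qed

lemma cortho_basis_quadratic_form:
  assumes B: "cortho_basis B" and ev: "\<And>u. u \<in> B \<Longrightarrow> S *v u = complex_of_real (\<mu> u) *s u"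
  shows "Re (cinner x (S *v x)) = (\<Sum>u\<in>B. \<mu> u * (cmod (cinner u x))\<^sup>2)"
proof -
  have fB: "finite B"
    using B by (simp add: cortho_basis_def)
  have "S *v x = (\<Sum>u\<in>B. (cinner u x * complex_of_real (\<mu> u)) *s u)"
    by (subst cortho_basis_matrix_vector_mult[OF B]) (simp add: ev vector_smult_assoc)
  then have "cinner x (S *v x) = (\<Sum>u\<in>B. complex_of_real (\<mu> u) * (cinner u x * cinner x u))"
    by (simp add: cinner_sum_right[OF fB] cinner_scale_right mult_ac)
  also have "\<dots> = (\<Sum>u\<in>B. complex_of_real (\<mu> u * (cmod (cinner u x))\<^sup>2))"
    by (simp add: cinner_commute[of x] complex_norm_square[symmetric])
  finally show ?thesis
    by simp
qed

lemma cortho_basis_norm_square: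
  "cortho_basis B \<Longrightarrow> (norm x)\<^sup>2 = (\<Sum>u\<in>B. (cmod (cinner u x))\<^sup>2)"
  using cortho_basis_quadratic_form[of B "mat 1" "\<lambda>_. 1" x] by (simp add: Re_cinner_self)

lemma hermitian_form_perturbation:
  fixes t :: real
  assumes h: "hermitian_mat H" and Hx0: "H *v x0 = g + complex_of_real l *s x0"
    and gx0: "cinner g x0 = 0" and x0: "norm x0 = 1"
  defines "b \<equiv> complex_of_real t *s g"
  shows "Re (cinner (x0 - b) (H *v (x0 - b))) = l - 2 * t * (norm g)\<^sup>2 + t\<^sup>2 * Re (cinner g (H *v g))"
    and "(norm (x0 - b))\<^sup>2 = 1 + t\<^sup>2 * (norm g)\<^sup>2"
proof -
  have x0g: "cinner x0 g = 0"
    using gx0 cinner_commute[of x0 g] by simp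
  have "cinner (x0 - b) (H *v (x0 - b)) =
      cinner x0 (H *v x0) - cinner x0 (H *v b) - cinner b (H *v x0) + cinner b (H *v b)"
    by (simp add: matrix_vector_mult_diff_distrib cinner_diff_left cinner_diff_right)
  also have "cinner x0 (H *v x0) = complex_of_real l"
    using x0 x0g by (simp add: Hx0 cinner_add_right cinner_scale_right cinner_self)
  also have "cinner x0 (H *v b) = cinner (H *v x0) b"
    by (rule hermitian_cinner[OF h])
  also have "cinner (H *v x0) b = complex_of_real t * cinner g g"
    using x0g by (simp add: Hx0 b_def cinner_add_left cinner_scale_left cinner_scale_right)
  also have "cinner b (H *v x0) = complex_of_real t * cinner g g"
    using gx0 by (simp add: Hx0 b_def cinner_add_right cinner_scale_left cinner_scale_right)
  also have "cinner b (H *v b) = complex_of_real (t\<^sup>2) * cinner g (H *v g)"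
    by (simp add: b_def matrix_vector_mult_scale cinner_scale_left cinner_scale_right power2_eq_square)
  finally show "Re (cinner (x0 - b) (H *v (x0 - b))) = l - 2 * t * (norm g)\<^sup>2 + t\<^sup>2 * Re (cinner g (H *v g))"
    by (simp add: cinner_self)
  have "(norm (x0 - b))\<^sup>2 = Re (cinner x0 x0 - cinner x0 b - cinner b x0 + cinner b b)"
    by (simp add: Re_cinner_self[symmetric] cinner_diff_left cinner_diff_right)
  also have "\<dots> = 1 + t\<^sup>2 * (norm g)\<^sup>2"
    using gx0 x0g x0 unfolding b_def cinner_scale_left cinner_scale_right
    by (simp add: cinner_self power2_eq_square)
  finally show "(norm (x0 - b))\<^sup>2 = 1 + t\<^sup>2 * (norm g)\<^sup>2" .
qed

lemma hermitian_minimizer_eigenvector: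
  assumes h: "hermitian_mat H"
    and W_diff: "\<And>y z. y \<in> W \<Longrightarrow> z \<in> W \<Longrightarrow> y - z \<in> W"
    and W_scale: "\<And>y c. y \<in> W \<Longrightarrow> c *s y \<in> W"
    and W_inv: "\<And>y. y \<in> W \<Longrightarrow> H *v y \<in> W"
    and x0: "x0 \<in> W" "norm x0 = 1"
    and min: "\<And>y. y \<in> W \<Longrightarrow> l * (norm y)\<^sup>2 \<le> Re (cinner y (H *v y))"
    and l: "l = Re (cinner x0 (H *v x0))"
  shows "H *v x0 = complex_of_real l *s x0"
proof (rule ccontr)
  define g where "g = H *v x0 - complex_of_real l *s x0"
  assume "H *v x0 \<noteq> complex_of_real l *s x0"
  then have n_pos: "0 < (norm g)\<^sup>2"
    by (simp add: g_def)
  have gW: "g \<in> W"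
    unfolding g_def by (rule W_diff[OF W_inv W_scale]) (use x0(1) in simp_all)
  have "cinner x0 (H *v x0) = complex_of_real l"
    using hermitian_cinner_real[OF h, of x0] l by simp
  then have gx0: "cinner g x0 = 0"
    using x0(2) by (simp add: g_def cinner_diff_left cinner_scale_left hermitian_cinner[OF h, symmetric] cinner_self)
  define q where "q = Re (cinner g (H *v g)) - l * (norm g)\<^sup>2"
  have q0: "0 \<le> q"
    using min[OF gW] by (simp add: q_def)
  \<comment> \<open>moving \<open>x0\<close> by \<open>-t g\<close> for small \<open>t > 0\<close> would lower the Rayleigh quotient below \<open>l\<close>\<close>
  define t where "t = (norm g)\<^sup>2 / (q + 1)"
  have t_pos: "0 < t" and tq: "t * q < (norm g)\<^sup>2"
    using n_pos q0 by (simp_all add: t_def field_simps)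
  have "H *v x0 = g + complex_of_real l *s x0"
    by (simp add: g_def)
  note perturbation = hermitian_form_perturbation[OF h this gx0 x0(2), of t]
  have "x0 - complex_of_real t *s g \<in> W"
    by (rule W_diff[OF x0(1) W_scale[OF gW]])
  from min[OF this] have "0 \<le> t * (t * q - 2 * (norm g)\<^sup>2)"
    unfolding perturbation by (simp add: q_def algebra_simps power2_eq_square)
  moreover have "t * (t * q - 2 * (norm g)\<^sup>2) < 0"
    using mult_pos_neg[OF t_pos, of "t * q - 2 * (norm g)\<^sup>2"] tq n_pos by linarith
  ultimately show False
    by simp
qed

lemma quadratic_form_attains_min:
  fixes H :: "complex^'n^'n"
  assumes "closed W" and W_scale: "\<And>y c. y \<in> W \<Longrightarrow> c *s y \<in> W" and "w \<in> W" "w \<noteq> 0"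
  obtains x0 where "x0 \<in> W" "norm x0 = 1"
    "\<And>y. y \<in> W \<Longrightarrow> Re (cinner x0 (H *v x0)) * (norm y)\<^sup>2 \<le> Re (cinner y (H *v y))"
proof -
  define f where "f y = Re (cinner y (H *v y))" for y
  define K where "K = W \<inter> sphere 0 1"
  have "compact K"
    unfolding K_def using \<open>closed W\<close> by (intro closed_Int_compact compact_sphere)
  have normalize: "complex_of_real (1 / norm y) *s y \<in> K" if "y \<in> W" "y \<noteq> 0" for y
    using that W_scale[OF that(1)] by (simp add: K_def norm_vector_scale norm_divide)
  then have "K \<noteq> {}"
    using assms(3,4) by blast
  moreover have "continuous_on K f"
    unfolding f_def by (intro continuous_intros)
  ultimately obtain x0 where x0: "x0 \<in> K" and x0_min: "\<And>y. y \<in> K \<Longrightarrow> f x0 \<le> f y"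
    using continuous_attains_inf[OF \<open>compact K\<close>] by blast
  have f_scale: "f (c *s y) = (cmod c)\<^sup>2 * f y" for c y
  proof -
    have "cinner (c *s y) (H *v (c *s y)) = (cnj c * c) * cinner y (H *v y)"
      by (simp add: matrix_vector_mult_scale cinner_scale_left cinner_scale_right)
    then show ?thesis
      by (simp add: f_def complex_norm_square[symmetric] mult.commute)
  qed
  have "f x0 * (norm y)\<^sup>2 \<le> f y" if "y \<in> W" for y
  proof (cases "y = 0")
    case False
    have "f x0 \<le> f y / (norm y)\<^sup>2"
      using x0_min[OF normalize[OF that False]] by (simp add: f_scale power_divide norm_divide)
    then show ?thesis
      using False by (simp add: field_simps)
  qed (simp add: f_def)
  then show ?thesis
    using x0 that by (auto simp: K_def f_def)
qed

lemma hermitian_eigenvector_orthogonal: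
  fixes H :: "complex^'n^'n"
  assumes h: "hermitian_mat H" and fB: "finite B"
    and eB: "\<And>u. u \<in> B \<Longrightarrow> \<exists>l::real. H *v u = complex_of_real l *s u"
    and w: "w \<noteq> 0" "\<forall>u\<in>B. cinner u w = 0"
  obtains e l where "\<forall>u\<in>B. cinner u e = 0" "cinner e e = 1" "H *v e = complex_of_real l *s e"
proof -
  define W where "W = {y::complex^'n. \<forall>u\<in>B. cinner u y = 0}"
  have W_diff: "y - z \<in> W" if "y \<in> W" "z \<in> W" for y z
    using that by (auto simp: W_def cinner_diff_right)
  have W_scale: "c *s y \<in> W" if "y \<in> W" for y c
    using that by (auto simp: W_def cinner_scale_right)
  have W_inv: "H *v y \<in> W" if "y \<in> W" for y
    using that eB by (fastforce simp: W_def hermitian_cinner[OF h] cinner_scale_left)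
  have "W = (\<Inter>u\<in>B. {y. cinner u y = 0})"
    by (auto simp: W_def)
  moreover have "closed {y. cinner u y = 0}" for u
    by (intro closed_Collect_eq continuous_intros)
  ultimately have "closed W"
    by auto
  then obtain x0 where x0: "x0 \<in> W" "norm x0 = 1"
    and min: "\<And>y. y \<in> W \<Longrightarrow> Re (cinner x0 (H *v x0)) * (norm y)\<^sup>2 \<le> Re (cinner y (H *v y))"
    using quadratic_form_attains_min[OF _ W_scale, of w H] w by (auto simp: W_def)
  have "H *v x0 = complex_of_real (Re (cinner x0 (H *v x0))) *s x0"
    by (rule hermitian_minimizer_eigenvector[OF h W_diff W_scale W_inv x0 min refl])
  moreover have "cinner x0 x0 = 1"
    using x0(2) by (simp add: cinner_self)
  ultimately show ?thesis
    using x0(1) that by (auto simp: W_def)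
qed

definition orthonormal_eigenvectors :: "complex^'n^'n \<Rightarrow> (complex^'n) set \<Rightarrow> bool" where
  "orthonormal_eigenvectors H B \<longleftrightarrow> finite B \<and> (\<forall>u\<in>B. cinner u u = 1) \<and>
     (\<forall>u\<in>B. \<forall>v\<in>B. u \<noteq> v \<longrightarrow> cinner u v = 0) \<and>
     (\<forall>u\<in>B. \<exists>l::real. H *v u = complex_of_real l *s u)"

lemma orthonormal_eigenvectors_card_le:
  fixes H :: "complex^'n^'n"
  assumes "orthonormal_eigenvectors H B"
  shows "card B \<le> DIM(complex^'n)"
proof -
  have "pairwise orthogonal B" "0 \<notin> B"
    using assms by (auto simp: orthonormal_eigenvectors_def pairwise_def orthogonal_def Re_cinner[symmetric])
  then have "independent B"
    by (rule pairwise_orthogonal_independent)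
  then show ?thesis
    using independent_bound by blast
qed

lemma orthonormal_eigenvectors_extend:
  assumes h: "hermitian_mat H" and B: "orthonormal_eigenvectors H B"
    and x: "(\<Sum>u\<in>B. cinner u x *s u) \<noteq> x"
  obtains e where "e \<notin> B" "orthonormal_eigenvectors H (insert e B)"
proof -
  have fB: "finite B" and on1: "\<And>u. u \<in> B \<Longrightarrow> cinner u u = 1"
    and on0: "\<And>u v. u \<in> B \<Longrightarrow> v \<in> B \<Longrightarrow> u \<noteq> v \<Longrightarrow> cinner u v = 0"
    and eigen: "\<And>u. u \<in> B \<Longrightarrow> \<exists>l::real. H *v u = complex_of_real l *s u"
    using B by (auto simp: orthonormal_eigenvectors_def)
  define w where "w = x - (\<Sum>u\<in>B. cinner u x *s u)"
  have "w \<noteq> 0"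
    using x by (simp add: w_def)
  moreover have "\<forall>v\<in>B. cinner v w = 0"
  proof
    fix v assume v: "v \<in> B"
    have "cinner v (\<Sum>u\<in>B. cinner u x *s u) = (\<Sum>u\<in>B. if u = v then cinner v x else 0)"
      using on1 on0 v by (auto simp: cinner_sum_right[OF fB] cinner_scale_right intro: sum.cong)
    then show "cinner v w = 0"
      using v fB by (simp add: w_def cinner_diff_right)
  qed
  ultimately obtain e l where e: "\<forall>u\<in>B. cinner u e = 0" "cinner e e = 1"
      "H *v e = complex_of_real l *s e"
    using hermitian_eigenvector_orthogonal[OF h fB eigen] by blast
  then have "e \<notin> B"
    by auto
  moreover have "cinner e u = 0" if "u \<in> B" for u
    using e(1) that cinner_commute[of u e] by simp
  ultimately show ?thesis
    using B e that by (auto simp: orthonormal_eigenvectors_def)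
qed

theorem hermitian_spectral:
  fixes H :: "complex^'n^'n"
  assumes h: "hermitian_mat H"
  obtains B lam where "cortho_basis B" "\<And>u. u \<in> B \<Longrightarrow> H *v u = complex_of_real (lam u) *s u"
proof -
  have "orthonormal_eigenvectors H {}"
    by (simp add: orthonormal_eigenvectors_def)
  then obtain B where B: "orthonormal_eigenvectors H B"
    and B_max: "\<And>B'. orthonormal_eigenvectors H B' \<Longrightarrow> card B' \<le> card B"
    using ex_has_greatest_nat[of "orthonormal_eigenvectors H" "{}" card "DIM(complex^'n) + 1"]
      orthonormal_eigenvectors_card_le by fastforce
  have "(\<Sum>u\<in>B. cinner u x *s u) = x" for x
  proof (rule ccontr)
    assume "(\<Sum>u\<in>B. cinner u x *s u) \<noteq> x"
    then obtain e where "e \<notin> B" "orthonormal_eigenvectors H (insert e B)"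
      using orthonormal_eigenvectors_extend[OF h B] by blast
    then show False
      using B_max[of "insert e B"] B by (simp add: orthonormal_eigenvectors_def)
  qed
  then have "cortho_basis B"
    using B by (simp add: cortho_basis_def orthonormal_eigenvectors_def)
  moreover have "H *v u = complex_of_real (SOME l. H *v u = complex_of_real l *s u) *s u" if "u \<in> B" for u
    using B that someI_ex[of "\<lambda>l. H *v u = complex_of_real l *s u"] by (simp add: orthonormal_eigenvectors_def)
  ultimately show ?thesis
    by (rule that)
qed

section \<open>Square roots of Hermitian positive definite matrices\<close>

definition eigen_matrix :: "(complex^'n) set \<Rightarrow> (complex^'n \<Rightarrow> complex) \<Rightarrow> complex^'n^'n" where
  "eigen_matrix B c = (\<chi> i j. \<Sum>u\<in>B. c u * u$i * cnj (u$j))"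

lemma eigen_matrix_vector_mult:
  assumes "finite B"
  shows "eigen_matrix B c *v x = (\<Sum>u\<in>B. (c u * cinner u x) *s u)"
proof -
  have "(eigen_matrix B c *v x) $ i = (\<Sum>u\<in>B. (c u * cinner u x) *s u) $ i" for i
  proof -
    have "(eigen_matrix B c *v x) $ i = (\<Sum>j\<in>UNIV. \<Sum>u\<in>B. c u * (u$i * (cnj (u$j) * x$j)))"
      by (simp add: eigen_matrix_def matrix_vector_mult_def sum_distrib_right mult.assoc)
    also have "\<dots> = (\<Sum>u\<in>B. \<Sum>j\<in>UNIV. c u * (u$i * (cnj (u$j) * x$j)))"
      by (rule sum.swap)
    also have "\<dots> = (\<Sum>u\<in>B. (c u * cinner u x) *s u) $ i"
      by (simp add: cinner_def sum_distrib_left sum_component mult_ac)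
    finally show ?thesis .
  qed
  then show ?thesis
    by (simp add: vec_eq_iff)
qed

lemma eigen_matrix_basis:
  assumes "cortho_basis B" "u \<in> B"
  shows "eigen_matrix B c *v u = c u *s u"
proof -
  have fB: "finite B"
    using assms(1) by (simp add: cortho_basis_def)
  have "eigen_matrix B c *v u = (\<Sum>v\<in>B. if v = u then c u *s u else 0)"
    unfolding eigen_matrix_vector_mult[OF fB]
    using assms by (intro sum.cong refl) (auto simp: cortho_basis_def)
  then show ?thesis
    using assms(2) fB by simp
qed

lemma hermitian_eigen_matrix: "(\<And>u. u \<in> B \<Longrightarrow> cnj (c u) = c u) \<Longrightarrow> hermitian_mat (eigen_matrix B c)"
  by (simp add: hermitian_mat_def vec_eq_iff eigen_matrix_def cadj_def cnj_sum mult_ac)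

lemma hpd_injective:
  assumes "hpd_mat P" "0 \<le> s" "P *v z + complex_of_real s *s z = 0"
  shows "z = 0"
proof (rule ccontr)
  assume "z \<noteq> 0"
  then have "0 < Re (cinner z (P *v z))"
    using assms(1) by (simp add: hpd_mat_def)
  moreover have "Re (cinner z (P *v z)) + s * (norm z)\<^sup>2 = 0"
    using arg_cong[where f = "\<lambda>v. Re (cinner z v)", OF assms(3)]
    by (simp add: cinner_add_right cinner_scale_right cinner_self)
  ultimately show False
    using assms(2) by (smt (verit) zero_le_power2 mult_nonneg_nonneg)
qed

text \<open>\<open>(P + s)(P u - s u) = (P\<^sup>2 - s\<^sup>2) u\<close>, and \<open>P + s\<close> is injective.\<close>

lemma hpd_square_eigenvector:
  assumes P: "hpd_mat P" and s: "0 \<le> s" and eig: "(P ** P) *v u = complex_of_real (s\<^sup>2) *s u"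
  shows "P *v u = complex_of_real s *s u"
proof -
  define z where "z = P *v u - complex_of_real s *s u"
  have "P *v z = (P ** P) *v u - complex_of_real s *s (P *v u)"
    by (simp only: z_def matrix_vector_mult_diff_distrib matrix_vector_mult_scale matrix_vector_mul_assoc)
  moreover have "complex_of_real s *s z = complex_of_real s *s (P *v u) - complex_of_real (s\<^sup>2) *s u"
    by (simp only: z_def vector_ssub_ldistrib vector_smult_assoc power2_eq_square of_real_mult)
  ultimately have "P *v z + complex_of_real s *s z = 0"
    using eig by simp
  then have "z = 0"
    by (rule hpd_injective[OF P s])
  then show ?thesis
    by (simp add: z_def)
qed

lemma hpd_eigenvalue_pos:
  assumes "hpd_mat D" "cortho_basis B" "u \<in> B" "D *v u = complex_of_real l *s u"
  shows "0 < l"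
proof -
  have "0 < Re (cinner u (D *v u))"
    using assms(1) cortho_basis_nonzero[OF assms(2,3)] by (simp add: hpd_mat_def)
  also have "cinner u (D *v u) = complex_of_real l"
    using assms(2-4) by (simp add: cinner_scale_right cortho_basis_def)
  finally show ?thesis
    by simp
qed

lemma hpd_eigen_matrix:
  fixes B :: "(complex^'n) set"
  assumes B: "cortho_basis B" and pos: "\<And>u. u \<in> B \<Longrightarrow> 0 < c u"
  shows "hpd_mat (eigen_matrix B (\<lambda>u. complex_of_real (c u)))"
  unfolding hpd_mat_def
proof (intro conjI allI impI)
  show "hermitian_mat (eigen_matrix B (\<lambda>u. complex_of_real (c u)))"
    by (rule hermitian_eigen_matrix) simp
  fix x :: "complex^'n"
  assume "x \<noteq> 0"
  then obtain u where u: "u \<in> B" "cinner u x \<noteq> 0"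
    using cortho_basis_cinner_nonzero[OF B] by blast
  have "0 < c u * (cmod (cinner u x))\<^sup>2"
    using pos[OF u(1)] u(2) by simp
  also have "\<dots> \<le> (\<Sum>u\<in>B. c u * (cmod (cinner u x))\<^sup>2)"
    using B u(1) pos by (intro member_le_sum) (simp_all add: cortho_basis_def less_imp_le)
  also have "\<dots> = Re (cinner x (eigen_matrix B (\<lambda>u. complex_of_real (c u)) *v x))"
    by (rule cortho_basis_quadratic_form[OF B eigen_matrix_basis[OF B], symmetric])
  finally show "0 < Re (cinner x (eigen_matrix B (\<lambda>u. complex_of_real (c u)) *v x))" .
qed

theorem hpd_sqrt:
  fixes D :: "complex^'n^'n"
  assumes D: "hpd_mat D"
  shows "hpd_mat (hpd_sqrt D)" "hpd_sqrt D ** hpd_sqrt D = D"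
proof -
  have "hermitian_mat D"
    using D by (simp add: hpd_mat_def)
  obtain B lam where B: "cortho_basis B" and eig: "\<And>u. u \<in> B \<Longrightarrow> D *v u = complex_of_real (lam u) *s u"
    using hermitian_spectral[OF \<open>hermitian_mat D\<close>] by blast
  have lam_pos: "0 < lam u" if "u \<in> B" for u
    using hpd_eigenvalue_pos[OF D B that eig[OF that]] .
  define S where "S = eigen_matrix B (\<lambda>u. complex_of_real (sqrt (lam u)))"
  have S_hpd: "hpd_mat S"
    unfolding S_def using lam_pos by (intro hpd_eigen_matrix[OF B]) simp
  have S_eig: "S *v u = complex_of_real (sqrt (lam u)) *s u" if "u \<in> B" for u
    unfolding S_def by (rule eigen_matrix_basis[OF B that])
  have "(S ** S) *v u = D *v u" if "u \<in> B" for u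
  proof -
    have "(S ** S) *v u = complex_of_real (sqrt (lam u) * sqrt (lam u)) *s u"
      by (simp only: matrix_vector_mul_assoc[symmetric] S_eig[OF that] matrix_vector_mult_scale
          vector_smult_assoc of_real_mult)
    then show ?thesis
      using lam_pos[OF that] by (simp add: eig[OF that])
  qed
  then have "S ** S = D"
    by (rule cortho_basis_matrix_eqI[OF B])
  have S_unique: "P = S" if "hpd_mat P" "P ** P = D" for P
  proof (rule cortho_basis_matrix_eqI[OF B])
    fix u assume u: "u \<in> B"
    have "(P ** P) *v u = complex_of_real ((sqrt (lam u))\<^sup>2) *s u"
      using that(2) lam_pos[OF u] by (simp add: eig[OF u])
    then have "P *v u = complex_of_real (sqrt (lam u)) *s u"
      by (rule hpd_square_eigenvector[OF that(1), rotated]) (simp add: less_imp_le lam_pos[OF u])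
    then show "P *v u = S *v u"
      by (simp add: S_eig[OF u])
  qed
  have "hpd_sqrt D = S"
    unfolding hpd_sqrt_def by (rule the_equality) (use S_hpd \<open>S ** S = D\<close> S_unique in blast)+
  then show "hpd_mat (hpd_sqrt D)" "hpd_sqrt D ** hpd_sqrt D = D"
    using S_hpd \<open>S ** S = D\<close> by simp_all
qed

section \<open>The block matrices \<open>D\<^sub>\<gamma>\<close> and \<open>L\<close>\<close>

definition block_proj :: "('r \<Rightarrow> nat) \<Rightarrow> nat \<Rightarrow> complex^'r^'r" where
  "block_proj blk b = (\<chi> i j. if i = j \<and> blk i = b then 1 else 0)"

lemma block_proj_matrix_mult_nth:
  "(block_proj blk b ** G) $ i $ j = (if blk i = b then G $ i $ j else 0)"
proof -
  have "(block_proj blk b ** G) $ i $ j = (\<Sum>l\<in>UNIV. if l = i then (if blk i = b then G $ i $ j else 0) else 0)"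
    unfolding matrix_matrix_mult_def block_proj_def vec_lambda_beta by (intro sum.cong refl) auto
  then show ?thesis
    by simp
qed

lemma matrix_mult_block_proj_nth:
  "(G ** block_proj blk b) $ i $ j = (if blk j = b then G $ i $ j else 0)"
proof -
  have "(G ** block_proj blk b) $ i $ j = (\<Sum>l\<in>UNIV. if l = j then (if blk j = b then G $ i $ j else 0) else 0)"
    unfolding matrix_matrix_mult_def block_proj_def vec_lambda_beta by (intro sum.cong refl) auto
  then show ?thesis
    by simp
qed

lemma cadj_block_proj [simp]: "cadj (block_proj blk b) = block_proj blk b"
  by (simp add: vec_eq_iff block_proj_def)

lemma block_diagonal_sum:
  fixes blk :: "'r::finite \<Rightarrow> nat" and G :: "complex^'r^'r"
  shows "(\<chi> i j. if blk i = blk j then G $ i $ j else 0) =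
     (\<Sum>b\<in>range blk. block_proj blk b ** G ** block_proj blk b)"
proof -
  have "(if blk i = blk j then G $ i $ j else 0) =
      (\<Sum>b\<in>range blk. if b = blk i then (if blk j = blk i then G $ i $ j else 0) else 0)" for i j
    by (simp add: eq_commute)
  also have "\<dots> i j = (\<Sum>b\<in>range blk. (block_proj blk b ** G ** block_proj blk b) $ i $ j)" for i j
    by (intro sum.cong refl) (auto simp: block_proj_matrix_mult_nth matrix_mult_block_proj_nth)
  finally show ?thesis
    by (simp add: vec_eq_iff sum_component)
qed

lemma sum_matrix_vector_mult:
  "finite S \<Longrightarrow> (\<Sum>b\<in>S. M b) *v x = (\<Sum>b\<in>S. M b *v x)"
  by (induction S rule: finite_induct) (simp_all add: matrix_vector_mult_add_rdistrib)

lemma Dgam_block_decomposition: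
  "Dgam blk A g =
     (\<Sum>b\<in>range blk. (block_proj blk b ** A) ** cadj (block_proj blk b ** A)) + mat (complex_of_real g)"
proof -
  have "Dgam blk A g = (\<chi> i j. if blk i = blk j then (A ** cadj A) $ i $ j else 0) + mat (complex_of_real g)"
    by (simp add: vec_eq_iff Dgam_def mat_def)
  then show ?thesis
    by (simp add: block_diagonal_sum cadj_matrix_mult matrix_mul_assoc)
qed

lemma Dgam_quadratic_form_ge: "g * (norm x)\<^sup>2 \<le> Re (cinner x (Dgam blk A g *v x))"
proof -
  have "Re (cinner x (Dgam blk A g *v x)) =
      (\<Sum>b\<in>range blk. (norm (cadj (block_proj blk b ** A) *v x))\<^sup>2) + g * (norm x)\<^sup>2"
    by (simp add: Dgam_block_decomposition matrix_vector_mult_add_rdistrib cinner_add_right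
        mat_matrix_vector_mult cinner_scale_right cinner_self cinner_cadj_self
        sum_matrix_vector_mult cinner_sum_right del: of_real_power)
  then show ?thesis
    by (simp add: sum_nonneg)
qed

lemma cnj_gram_nth: "cnj ((A ** cadj A) $ j $ i) = (A ** cadj A) $ i $ j"
  by (simp add: matrix_matrix_mult_def cnj_sum mult.commute)

lemma hpd_Dgam: "0 < g \<Longrightarrow> hpd_mat (Dgam blk A g)"
  unfolding hpd_mat_def hermitian_mat_def
proof (intro conjI allI impI)
  show "cadj (Dgam blk A g) = Dgam blk A g"
    by (auto simp: vec_eq_iff Dgam_def cnj_gram_nth)
  fix x :: "complex^'a"
  assume "0 < g" "x \<noteq> 0"
  then show "0 < Re (cinner x (Dgam blk A g *v x))"
    using Dgam_quadratic_form_ge[of g x] by (smt (verit) mult_pos_pos zero_less_power2 zero_less_norm_iff)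
qed

lemma Dgam_Lblk_plus_cadj:
  "(Dgam blk A g + Lblk blk A) + cadj (Dgam blk A g + Lblk blk A) = Dgam blk A (2 * g) + A ** cadj A"
  by (auto simp: vec_eq_iff Dgam_def Lblk_def cnj_gram_nth)

lemma Dgam_Lblk_quadratic_form_pos:
  assumes "0 < \<gamma>" "x \<noteq> 0"
  shows "0 < Re (cinner x ((Dgam blk A \<gamma> + Lblk blk A) *v x))"
proof -
  let ?K = "Dgam blk A \<gamma> + Lblk blk A"
  have "Re (cinner x (cadj ?K *v x)) = Re (cinner x (?K *v x))"
    by (simp add: cinner_cadj_left[symmetric] cinner_commute[of "?K *v x"])
  then have "2 * Re (cinner x (?K *v x)) =
      Re (cinner x (Dgam blk A (2 * \<gamma>) *v x)) + (norm (cadj A *v x))\<^sup>2"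
    using arg_cong[where f = "\<lambda>M. Re (cinner x (M *v x))", OF Dgam_Lblk_plus_cadj[of blk A \<gamma>]]
    by (simp add: matrix_vector_mult_add_rdistrib cinner_add_right cinner_cadj_self del: of_real_power)
  moreover have "0 < 2 * \<gamma> * (norm x)\<^sup>2"
    using assms by simp
  ultimately show ?thesis
    using Dgam_quadratic_form_ge[of "2 * \<gamma>" x blk A] by (smt (verit) zero_le_power2)
qed

lemma Mgam_inverse:
  assumes "0 < \<gamma>"
  shows "Mgam blk A \<gamma> ** (Dgam blk A \<gamma> + Lblk blk A) = mat 1"
    and "(Dgam blk A \<gamma> + Lblk blk A) ** Mgam blk A \<gamma> = mat 1"
proof -
  let ?K = "Dgam blk A \<gamma> + Lblk blk A"
  have "x = 0" if "?K *v x = 0" for x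
    using Dgam_Lblk_quadratic_form_pos[OF assms, of x blk A] that by fastforce
  then have "invertible ?K"
    by (simp add: invertible_left_inverse matrix_left_invertible_ker)
  then have "?K ** matrix_inv ?K = mat 1 \<and> matrix_inv ?K ** ?K = mat 1"
    unfolding matrix_inv_def invertible_def by (rule someI_ex)
  then show "Mgam blk A \<gamma> ** ?K = mat 1" "?K ** Mgam blk A \<gamma> = mat 1"
    by (simp_all add: Mgam_def)
qed

section \<open>Linear images of Gaussian limits\<close>

lemma matrix_vector_mult_measurable:
  "sets M = sets borel \<Longrightarrow> (\<lambda>x. (B::complex^'r^'n) *v x) \<in> measurable M borel"
  using borel_measurable_continuous_onI[OF linear_continuous_on[OF matrix_vector_mul_bounded_linear]]
    measurable_cong_sets by blast

lemma conv_in_distr_matrix_image: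
  fixes B :: "complex^'r^'n" and X :: "nat \<Rightarrow> 'a \<Rightarrow> complex^'r"
  assumes conv: "conv_in_distr P X \<mu>"
  shows "conv_in_distr P (\<lambda>N \<omega>. B *v X N \<omega>) (distr \<mu> borel (\<lambda>x. B *v x))"
proof -
  have sets_\<mu>: "sets \<mu> = sets borel" and "prob_space \<mu>"
    using conv by (auto simp: conv_in_distr_def)
  have B_meas: "(\<lambda>x. B *v x) \<in> measurable \<mu> borel"
    by (rule matrix_vector_mult_measurable[OF sets_\<mu>])
  show ?thesis
    unfolding conv_in_distr_def
  proof (intro conjI allI impI)
    fix N
    show "prob_space (P N)" "(\<lambda>\<omega>. B *v X N \<omega>) \<in> borel_measurable (P N)"
      using conv matrix_vector_mult_measurable[of borel B]
      by (auto simp: conv_in_distr_def intro: measurable_compose)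
  next
    show "prob_space (distr \<mu> borel ((*v) B))"
      using prob_space.prob_space_distr[OF \<open>prob_space \<mu>\<close> B_meas] by simp
    show "sets (distr \<mu> borel ((*v) B)) = sets borel"
      by simp
  next
    fix f :: "complex^'n \<Rightarrow> real"
    assume f: "continuous_on UNIV f" "bounded (range f)"
    have "continuous_on UNIV (\<lambda>x. f (B *v x))"
      by (rule continuous_on_compose2[OF f(1) linear_continuous_on[OF matrix_vector_mul_bounded_linear]]) auto
    moreover have "bounded (range (\<lambda>x. f (B *v x)))"
      by (rule bounded_subset[OF f(2)]) auto
    ultimately have "(\<lambda>N. \<integral>\<omega>. f (B *v X N \<omega>) \<partial>P N) \<longlonglongrightarrow> (\<integral>x. f (B *v x) \<partial>\<mu>)"
      using conv by (auto simp: conv_in_distr_def)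
    then show "(\<lambda>N. \<integral>\<omega>. f (B *v X N \<omega>) \<partial>P N) \<longlonglongrightarrow> integral\<^sup>L (distr \<mu> borel ((*v) B)) f"
      by (simp add: integral_distr[OF B_meas borel_measurable_continuous_onI[OF f(1)]])
  qed
qed

lemma matrix_vector_mult_second_moment:
  "(B *v x) $ i * cnj ((B *v x) $ j) =
     (\<Sum>a\<in>UNIV. \<Sum>b\<in>UNIV. (B$i$a * cnj (B$j$b)) * (x$a * cnj (x$b)))"
  unfolding matrix_vector_mult_def by (simp add: cnj_sum sum_product mult_ac)

lemma matrix_congruence_nth:
  "(B ** \<Theta> ** cadj B) $ i $ j = (\<Sum>a\<in>UNIV. \<Sum>b\<in>UNIV. (B$i$a * cnj (B$j$b)) * \<Theta>$a$b)"
proof -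
  have "(B ** \<Theta> ** cadj B) $ i $ j = (\<Sum>b\<in>UNIV. \<Sum>a\<in>UNIV. (B$i$a * cnj (B$j$b)) * \<Theta>$a$b)"
    by (simp add: matrix_matrix_mult_def sum_distrib_left sum_distrib_right mult_ac)
  also have "\<dots> = (\<Sum>a\<in>UNIV. \<Sum>b\<in>UNIV. (B$i$a * cnj (B$j$b)) * \<Theta>$a$b)"
    by (rule sum.swap)
  finally show ?thesis .
qed

lemma centered_gaussian_matrix_image:
  fixes B :: "complex^'r^'n"
  assumes gauss: "centered_gaussian \<mu> \<Theta>"
  shows "centered_gaussian (distr \<mu> borel (\<lambda>x. B *v x)) (B ** \<Theta> ** cadj B)"
proof -
  have "prob_space \<mu>" and sets_\<mu>: "sets \<mu> = sets borel"
    using gauss by (auto simp: centered_gaussian_def)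
  have moments: "integrable \<mu> (\<lambda>x. x $ a * cnj (x $ b))" "(\<integral>x. x $ a * cnj (x $ b) \<partial>\<mu>) = \<Theta> $ a $ b" for a b
    using gauss by (auto simp: centered_gaussian_def)
  have B_meas: "(\<lambda>x. B *v x) \<in> measurable \<mu> borel"
    by (rule matrix_vector_mult_measurable[OF sets_\<mu>])
  have entry_meas: "(\<lambda>y::complex^'n. y $ i * cnj (y $ j)) \<in> borel_measurable borel" for i j
    by (intro borel_measurable_continuous_onI continuous_intros)
  show ?thesis
    unfolding centered_gaussian_def
  proof (intro conjI allI impI)
    show "prob_space (distr \<mu> borel ((*v) B))"
      using prob_space.prob_space_distr[OF \<open>prob_space \<mu>\<close> B_meas] by simp
    show "sets (distr \<mu> borel ((*v) B)) = sets borel"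
      by simp
  next
    fix l :: "complex^'n \<Rightarrow> real"
    assume l: "linear l"
    have "l \<in> measurable borel borel"
      using l by (intro borel_measurable_continuous_onI linear_continuous_on)
        (simp add: linear_conv_bounded_linear)
    then have "distr (distr \<mu> borel ((*v) B)) borel l = distr \<mu> borel (l \<circ> (*v) B)"
      by (rule distr_distr[OF _ B_meas])
    moreover have "linear (l \<circ> (*v) B)"
      by (rule linear_compose[OF matrix_vector_mul_linear l])
    ultimately show "\<exists>v\<ge>0. distr (distr \<mu> borel ((*v) B)) borel l = centered_normal v"
      using gauss by (simp add: centered_gaussian_def)
  next
    fix i j
    have "integrable \<mu> (\<lambda>x. (B *v x) $ i * cnj ((B *v x) $ j))"
      unfolding matrix_vector_mult_second_moment
      by (intro Bochner_Integration.integrable_sum integrable_mult_right moments)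
    then show "integrable (distr \<mu> borel ((*v) B)) (\<lambda>x. x $ i * cnj (x $ j))"
      by (simp add: integrable_distr_eq[OF B_meas entry_meas])
    have "(\<integral>x. x $ i * cnj (x $ j) \<partial>distr \<mu> borel ((*v) B)) =
        (\<integral>x. (B *v x) $ i * cnj ((B *v x) $ j) \<partial>\<mu>)"
      by (rule integral_distr[OF B_meas entry_meas])
    also have "\<dots> = (B ** \<Theta> ** cadj B) $ i $ j"
      unfolding matrix_vector_mult_second_moment matrix_congruence_nth
      by (simp add: Bochner_Integration.integral_sum Bochner_Integration.integrable_sum moments)
    finally show "(\<integral>x. x $ i * cnj (x $ j) \<partial>distr \<mu> borel ((*v) B)) = (B ** \<Theta> ** cadj B) $ i $ j" .
  qed
qed

section \<open>Singular values\<close>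

lemma gram_spectral:
  fixes R :: "complex^'n^'m"
  obtains B \<mu> where "cortho_basis B"
    and "\<And>u. u \<in> B \<Longrightarrow> (cadj R ** R) *v u = complex_of_real (\<mu> u) *s u"
    and "\<And>u. u \<in> B \<Longrightarrow> \<mu> u = (norm (R *v u))\<^sup>2"
proof -
  have "hermitian_mat (cadj R ** R)"
    by (simp add: hermitian_mat_def cadj_matrix_mult)
  then obtain B \<mu> where B: "cortho_basis B"
    and eig: "\<And>u. u \<in> B \<Longrightarrow> (cadj R ** R) *v u = complex_of_real (\<mu> u) *s u"
    using hermitian_spectral by blast
  have "\<mu> u = (norm (R *v u))\<^sup>2" if "u \<in> B" for u
  proof -
    have "complex_of_real (\<mu> u) = cinner u ((cadj R ** R) *v u)"
      using B that by (simp add: eig cinner_scale_right cortho_basis_def)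
    also have "\<dots> = complex_of_real ((norm (R *v u))\<^sup>2)"
      using cinner_cadj_self[of u "cadj R"] by simp
    finally show ?thesis
      by (simp only: of_real_eq_iff)
  qed
  with B eig show ?thesis
    by (rule that)
qed

lemma nonzero_singular_values_eq:
  fixes R :: "complex^'n^'m"
  assumes B: "cortho_basis B" and eig: "\<And>u. u \<in> B \<Longrightarrow> (cadj R ** R) *v u = complex_of_real (\<mu> u) *s u"
  shows "singular_values R - {0} = (\<lambda>u. sqrt (\<mu> u)) ` {u \<in> B. 0 < \<mu> u}"
proof
  show "singular_values R - {0} \<subseteq> (\<lambda>u. sqrt (\<mu> u)) ` {u \<in> B. 0 < \<mu> u}"
  proof
    fix s
    assume "s \<in> singular_values R - {0}"
    then obtain v where s: "0 < s" and "v \<noteq> 0" and v: "(cadj R ** R) *v v = complex_of_real (s\<^sup>2) *s v"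
      by (auto simp: singular_values_def)
    then obtain u where u: "u \<in> B" "cinner u v \<noteq> 0"
      using cortho_basis_cinner_nonzero[OF B] by blast
    have "complex_of_real (\<mu> u) * cinner u v = cinner ((cadj R ** R) *v u) v"
      by (simp add: eig[OF u(1)] cinner_scale_left)
    also have "\<dots> = complex_of_real (s\<^sup>2) * cinner u v"
      by (simp add: hermitian_cinner[symmetric] hermitian_mat_def cadj_matrix_mult v cinner_scale_right)
    finally have "\<mu> u = s\<^sup>2"
      using u(2) by (metis mult_cancel_right of_real_eq_iff)
    then show "s \<in> (\<lambda>u. sqrt (\<mu> u)) ` {u \<in> B. 0 < \<mu> u}"
      using u(1) s by force
  qed
next
  show "(\<lambda>u. sqrt (\<mu> u)) ` {u \<in> B. 0 < \<mu> u} \<subseteq> singular_values R - {0}"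
  proof
    fix s
    assume "s \<in> (\<lambda>u. sqrt (\<mu> u)) ` {u \<in> B. 0 < \<mu> u}"
    then obtain u where u: "u \<in> B" "0 < \<mu> u" and s: "s = sqrt (\<mu> u)"
      by blast
    then have "(cadj R ** R) *v u = complex_of_real (s\<^sup>2) *s u"
      by (simp add: eig)
    moreover have "0 \<le> s" "s \<noteq> 0"
      using u s by simp_all
    ultimately show "s \<in> singular_values R - {0}"
      unfolding singular_values_def using cortho_basis_nonzero[OF B u(1)] by blast
  qed
qed

lemma min_nonzero_sv_attained:
  fixes R :: "complex^'n^'m"
  assumes "R \<noteq> 0"
  shows "0 < min_nonzero_sv R" and "\<exists>u. norm u = 1 \<and> norm (R *v u) = min_nonzero_sv R"
proof -
  obtain B \<mu> where B: "cortho_basis B"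
    and eig: "\<And>u. u \<in> B \<Longrightarrow> (cadj R ** R) *v u = complex_of_real (\<mu> u) *s u"
    and \<mu>: "\<And>u. u \<in> B \<Longrightarrow> \<mu> u = (norm (R *v u))\<^sup>2"
    using gram_spectral[of R] by blast
  let ?X = "singular_values R - {0}"
  have "\<exists>u\<in>B. 0 < \<mu> u"
  proof (rule ccontr)
    assume "\<not> (\<exists>u\<in>B. 0 < \<mu> u)"
    then have "(norm (R *v u))\<^sup>2 \<le> 0" if "u \<in> B" for u
      using \<mu>[OF that] that by (metis not_less)
    then have "R *v u = 0 *v u" if "u \<in> B" for u
      using that by simp
    then have "R = 0"
      by (rule cortho_basis_matrix_eqI[OF B])
    with assms show False ..
  qed
  moreover have "finite B"
    using B by (simp add: cortho_basis_def)
  ultimately have fin: "finite ?X" and ne: "?X \<noteq> {}"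
    by (auto simp: nonzero_singular_values_eq[OF B eig])
  have "min_nonzero_sv R \<in> ?X"
    unfolding min_nonzero_sv_def cInf_eq_Min[OF fin ne] by (rule Min_in[OF fin ne])
  then obtain u where u: "u \<in> B" "0 < \<mu> u" "min_nonzero_sv R = sqrt (\<mu> u)"
    by (auto simp: nonzero_singular_values_eq[OF B eig])
  then show "0 < min_nonzero_sv R"
    by simp
  have "norm u = 1"
    by (rule cortho_basis_norm[OF B u(1)])
  moreover have "norm (R *v u) = min_nonzero_sv R"
    using u \<mu> by simp
  ultimately show "\<exists>u. norm u = 1 \<and> norm (R *v u) = min_nonzero_sv R"
    by blast
qed

lemma min_nonzero_sv_le:
  fixes R :: "complex^'n^'m"
  assumes ker: "\<And>v. R *v v = 0 \<Longrightarrow> cinner v x = 0"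
  shows "min_nonzero_sv R * norm x \<le> norm (R *v x)"
proof (cases "min_nonzero_sv R \<le> 0")
  case False
  obtain B \<mu> where B: "cortho_basis B"
    and eig: "\<And>u. u \<in> B \<Longrightarrow> (cadj R ** R) *v u = complex_of_real (\<mu> u) *s u"
    and \<mu>: "\<And>u. u \<in> B \<Longrightarrow> \<mu> u = (norm (R *v u))\<^sup>2"
    using gram_spectral[of R] by blast
  let ?\<sigma> = "min_nonzero_sv R"
  have "?\<sigma>\<^sup>2 * (cmod (cinner u x))\<^sup>2 \<le> \<mu> u * (cmod (cinner u x))\<^sup>2" if u: "u \<in> B" for u
  proof (cases "0 < \<mu> u")
    case True
    then have "sqrt (\<mu> u) \<in> singular_values R - {0}"
      using u by (auto simp: nonzero_singular_values_eq[OF B eig])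
    then have "?\<sigma> \<le> sqrt (\<mu> u)"
      unfolding min_nonzero_sv_def by (rule cInf_lower) (auto simp: singular_values_def)
    then have "?\<sigma>\<^sup>2 \<le> \<mu> u"
      using False True by (metis less_imp_le not_le power_mono real_sqrt_pow2)
    then show ?thesis
      by (simp add: mult_right_mono)
  next
    case False
    then have "(norm (R *v u))\<^sup>2 \<le> 0"
      using \<mu>[OF u] by simp
    then have "R *v u = 0"
      by simp
    then show ?thesis
      by (simp add: ker)
  qed
  then have "?\<sigma>\<^sup>2 * (norm x)\<^sup>2 \<le> (\<Sum>u\<in>B. \<mu> u * (cmod (cinner u x))\<^sup>2)"
    by (simp add: cortho_basis_norm_square[OF B] sum_distrib_left sum_mono)
  also have "\<dots> = Re (cinner x ((cadj R ** R) *v x))"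
    by (rule cortho_basis_quadratic_form[OF B eig, symmetric])
  also have "\<dots> = (norm (R *v x))\<^sup>2"
    using cinner_cadj_self[of x "cadj R"] by simp
  finally have "(?\<sigma> * norm x)\<^sup>2 \<le> (norm (R *v x))\<^sup>2"
    by (simp add: power_mult_distrib)
  then show ?thesis
    using False by (simp add: power2_le_iff_abs_le)
qed (simp add: mult_nonpos_nonneg order.trans[OF _ norm_ge_zero])

section \<open>Contraction of the iteration on the range of the adjoint\<close>

lemma iteration_pythagoras:
  fixes A :: "complex^'n^'r" and K M Q :: "complex^'r^'r"
  assumes KM: "K ** M = mat 1" and Q: "hermitian_mat Q" and QQ: "Q ** Q + A ** cadj A = K + cadj K"
  shows "(norm ((mat 1 - cadj A ** M ** A) *v x))\<^sup>2 + (norm ((Q ** M ** A) *v x))\<^sup>2 = (norm x)\<^sup>2"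
proof -
  define a where "a = A *v x"
  define m where "m = M *v a"
  define G where "G = A ** cadj A"
  have Km: "K *v m = a"
    using KM by (simp add: m_def matrix_vector_mul_assoc)
  have xm: "cinner x (cadj A *v m) = cinner a m"
    by (simp add: cinner_cadj_left[symmetric] a_def)
  have mx: "cinner (cadj A *v m) x = cinner m a"
    using xm cinner_commute[of "cadj A *v m" x] cinner_commute[of m a] by simp
  have mm: "cinner (cadj A *v m) (cadj A *v m) = cinner m (G *v m)"
    by (simp add: G_def cinner_cadj_self cinner_self)
  have Tx: "(mat 1 - cadj A ** M ** A) *v x = x - cadj A *v m"
    by (simp add: m_def a_def matrix_vector_mult_diff_rdistrib matrix_vector_mul_assoc matrix_mul_assoc)
  have T: "cinner ((mat 1 - cadj A ** M ** A) *v x) ((mat 1 - cadj A ** M ** A) *v x) =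
      cinner x x - cinner a m - cinner m a + cinner m (G *v m)"
    unfolding Tx cinner_diff_left cinner_diff_right xm mx mm by (simp add: algebra_simps)
  have "(Q ** M ** A) *v x = Q *v m"
    by (simp add: m_def a_def matrix_vector_mul_assoc matrix_mul_assoc)
  then have "cinner ((Q ** M ** A) *v x) ((Q ** M ** A) *v x) = cinner m ((Q ** Q) *v m)"
    using hermitian_cinner[OF Q, of m "Q *v m"] by (simp add: matrix_vector_mul_assoc)
  also have "Q ** Q = K + cadj K - G"
    using QQ by (simp add: G_def algebra_simps)
  also have "cinner m ((K + cadj K - G) *v m) = cinner m a + cinner a m - cinner m (G *v m)"
    by (simp add: matrix_vector_mult_diff_rdistrib matrix_vector_mult_add_rdistrib cinner_add_right
        cinner_diff_right cinner_cadj_left[symmetric] Km)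
  finally have "cinner ((mat 1 - cadj A ** M ** A) *v x) ((mat 1 - cadj A ** M ** A) *v x) +
      cinner ((Q ** M ** A) *v x) ((Q ** M ** A) *v x) = cinner x x"
    by (simp add: T)
  from arg_cong[where f = Re, OF this] show ?thesis
    by (simp only: plus_complex.sel Re_cinner_self)
qed

lemma iteration_range_cadj:
  "(mat 1 - cadj A ** M ** A) *v (cadj A *v y) = cadj A *v (y - M *v (A *v (cadj A *v y)))"
proof -
  have "(mat 1 - cadj A ** M ** A) *v x = x - cadj A *v (M *v (A *v x))" for x
    by (simp add: matrix_vector_mult_diff_rdistrib matrix_vector_mul_assoc matrix_mul_assoc)
  then show ?thesis
    by (simp only: matrix_vector_mult_diff_distrib)
qed

lemma Rgam_pythagoras:
  assumes "0 < \<gamma>"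
  shows "(norm ((mat 1 - cadj A ** Mgam blk A \<gamma> ** A) *v x))\<^sup>2 + (norm (Rgam blk A \<gamma> *v x))\<^sup>2 = (norm x)\<^sup>2"
proof -
  let ?Q = "hpd_sqrt (Dgam blk A (2 * \<gamma>))"
  have "hpd_mat (Dgam blk A (2 * \<gamma>))"
    using assms by (simp add: hpd_Dgam)
  then have Q: "hermitian_mat ?Q" and QQ: "?Q ** ?Q = Dgam blk A (2 * \<gamma>)"
    using hpd_sqrt by (auto simp: hpd_mat_def)
  show ?thesis
    unfolding Rgam_def
    by (rule iteration_pythagoras[OF Mgam_inverse(2)[OF assms] Q]) (simp add: QQ Dgam_Lblk_plus_cadj)
qed

lemma Rgam_kernel:
  assumes "0 < \<gamma>" "Rgam blk A \<gamma> *v v = 0"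
  shows "A *v v = 0"
proof -
  let ?Q = "hpd_sqrt (Dgam blk A (2 * \<gamma>))" and ?M = "Mgam blk A \<gamma>"
  have "?Q *v (?M *v (A *v v)) + complex_of_real 0 *s (?M *v (A *v v)) = 0"
    using assms(2) by (simp add: Rgam_def matrix_vector_mul_assoc matrix_mul_assoc)
  then have "?M *v (A *v v) = 0"
    using hpd_injective hpd_sqrt(1) hpd_Dgam assms(1) by (metis mult_pos_pos order_refl zero_less_numeral)
  then have "(Dgam blk A \<gamma> + Lblk blk A) *v (?M *v (A *v v)) = 0"
    by simp
  then show ?thesis
    by (simp add: matrix_vector_mul_assoc matrix_mul_assoc Mgam_inverse(2)[OF assms(1)])
qed

lemma Rgam_nonzero: "0 < \<gamma> \<Longrightarrow> A \<noteq> 0 \<Longrightarrow> Rgam blk A \<gamma> \<noteq> 0"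
  using Rgam_kernel[of \<gamma> blk A] matrix_eq[of A 0] by auto

lemma Rgam_range_cadj_lower_bound:
  assumes "0 < \<gamma>"
  shows "sigma_gam blk A \<gamma> * norm (cadj A *v y) \<le> norm (Rgam blk A \<gamma> *v (cadj A *v y))"
  unfolding sigma_gam_def
proof (rule min_nonzero_sv_le)
  fix v
  assume "Rgam blk A \<gamma> *v v = 0"
  then have "A *v v = 0"
    by (rule Rgam_kernel[OF assms])
  then show "cinner v (cadj A *v y) = 0"
    using cinner_cadj_left[of "cadj A" v y] by simp
qed

theorem iteration_contraction:
  fixes A :: "complex^'n^'r" and blk :: "'r \<Rightarrow> nat"
  assumes "0 < \<gamma>" "A \<noteq> 0"
  defines "T \<equiv> mat 1 - cadj A ** Mgam blk A \<gamma> ** A" and "\<sigma> \<equiv> sigma_gam blk A \<gamma>"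
  shows "0 < \<sigma>" "\<sigma> \<le> 1" "norm (T *v (cadj A *v y)) \<le> sqrt (1 - \<sigma>\<^sup>2) * norm (cadj A *v y)"
proof -
  note R_nonzero = Rgam_nonzero[OF assms(1,2), of blk]
  then show "0 < \<sigma>"
    unfolding \<sigma>_def sigma_gam_def by (rule min_nonzero_sv_attained(1))
  obtain u where "norm u = 1" "norm (Rgam blk A \<gamma> *v u) = \<sigma>"
    using min_nonzero_sv_attained(2)[OF R_nonzero] by (auto simp: \<sigma>_def sigma_gam_def)
  then have "(norm (T *v u))\<^sup>2 + \<sigma>\<^sup>2 = 1"
    using Rgam_pythagoras[OF assms(1), of A blk u] by (simp add: T_def)
  then have "\<sigma>\<^sup>2 \<le> 1"
    using zero_le_power2[of "norm (T *v u)"] by linarith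
  then show "\<sigma> \<le> 1"
    using power2_le_imp_le[of \<sigma> 1] by simp
  let ?x = "cadj A *v y"
  have "(\<sigma> * norm ?x)\<^sup>2 \<le> (norm (Rgam blk A \<gamma> *v ?x))\<^sup>2"
    using Rgam_range_cadj_lower_bound[OF assms(1)] \<open>0 < \<sigma>\<close>
    by (intro power_mono) (simp_all add: \<sigma>_def)
  then have "(norm (T *v ?x))\<^sup>2 \<le> (1 - \<sigma>\<^sup>2) * (norm ?x)\<^sup>2"
    using Rgam_pythagoras[OF assms(1), of A blk ?x] by (simp add: T_def power_mult_distrib algebra_simps)
  also have "\<dots> = (sqrt (1 - \<sigma>\<^sup>2) * norm ?x)\<^sup>2"
    using \<open>\<sigma>\<^sup>2 \<le> 1\<close> by (simp add: power_mult_distrib)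
  finally show "norm (T *v ?x) \<le> sqrt (1 - \<sigma>\<^sup>2) * norm ?x"
    by (rule power2_le_imp_le) (use \<open>\<sigma>\<^sup>2 \<le> 1\<close> in simp)
qed

section \<open>The error of the iteration\<close>

primrec iter_matrix :: "complex^'n^'n \<Rightarrow> complex^'r^'n \<Rightarrow> nat \<Rightarrow> complex^'r^'n" where
  "iter_matrix T C 0 = 0"
| "iter_matrix T C (Suc k) = T ** iter_matrix T C k + C"

lemma qiter_iter_matrix: "qiter A M p k = iter_matrix (mat 1 - cadj A ** M ** A) (cadj A ** M) k *v p"
  by (induction k) (simp_all add: matrix_vector_mult_add_rdistrib matrix_vector_mul_assoc)

lemma iter_matrix_zero [simp]: "iter_matrix T 0 k = 0"
  by (induction k) simp_all

lemma iter_matrix_bound: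
  assumes V: "subspace V" and c: "0 \<le> c"
    and T: "\<And>v. v \<in> V \<Longrightarrow> T *v v \<in> V \<and> norm (T *v v) \<le> c * norm v"
    and C: "\<And>d. C *v d \<in> V"
  shows "iter_matrix T C k *v d \<in> V \<and> norm (iter_matrix T C k *v d) \<le> (\<Sum>j<k. c^j) * norm (C *v d)"
proof (induction k)
  case 0
  show ?case
    using V by (simp add: subspace_0)
next
  case (Suc k)
  let ?v = "iter_matrix T C k *v d"
  have v: "?v \<in> V" and norm_v: "norm ?v \<le> (\<Sum>j<k. c^j) * norm (C *v d)"
    using Suc.IH by blast+
  have step: "iter_matrix T C (Suc k) *v d = T *v ?v + C *v d"
    by (simp add: matrix_vector_mult_add_rdistrib matrix_vector_mul_assoc)
  have "norm (T *v ?v + C *v d) \<le> c * norm ?v + norm (C *v d)"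
    using T[OF v] by (intro order.trans[OF norm_triangle_ineq add_right_mono]) blast
  also have "\<dots> \<le> c * ((\<Sum>j<k. c^j) * norm (C *v d)) + norm (C *v d)"
    using mult_left_mono[OF norm_v c] by simp
  also have "c * ((\<Sum>j<k. c^j) * norm (C *v d)) + norm (C *v d) = (\<Sum>j<Suc k. c^j) * norm (C *v d)"
    by (simp add: sum.lessThan_Suc_shift sum_distrib_left algebra_simps del: sum.lessThan_Suc)
  finally show ?case
    unfolding step using subspace_add[OF V conjunct1[OF T[OF v]] C[of d]] by simp
qed

lemma cmat_norm_congruence: "cmat_norm (B ** \<Theta> ** cadj B) \<le> (cmat_norm B)\<^sup>2 * cmat_norm \<Theta>"
proof -
  have "cmat_norm (B ** \<Theta> ** cadj B) \<le> cmat_norm (B ** \<Theta>) * cmat_norm (cadj B)"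
    by (rule cmat_norm_matrix_mult)
  also have "\<dots> \<le> (cmat_norm B * cmat_norm \<Theta>) * cmat_norm B"
    by (intro mult_mono cmat_norm_matrix_mult cmat_norm_cadj cmat_norm_nonneg mult_nonneg_nonneg)
  finally show ?thesis
    by (simp add: power2_eq_square mult_ac)
qed

lemma iteration_contraction_on_range:
  fixes A :: "complex^'n^'r" and blk :: "'r \<Rightarrow> nat"
  assumes "0 < \<gamma>" "A \<noteq> 0" "v \<in> range (\<lambda>y. cadj A *v y)"
  defines "T \<equiv> mat 1 - cadj A ** Mgam blk A \<gamma> ** A"
  shows "T *v v \<in> range (\<lambda>y. cadj A *v y) \<and> norm (T *v v) \<le> sqrt (1 - (sigma_gam blk A \<gamma>)\<^sup>2) * norm v"
proof -
  obtain y where v: "v = cadj A *v y"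
    using assms(3) by blast
  then have "T *v v \<in> range (\<lambda>y. cadj A *v y)"
    unfolding T_def v iteration_range_cadj by blast
  moreover have "norm (T *v v) \<le> sqrt (1 - (sigma_gam blk A \<gamma>)\<^sup>2) * norm v"
    using iteration_contraction(3)[OF assms(1,2), of blk y] by (simp only: T_def v)
  ultimately show ?thesis ..
qed

lemma block_iter_matrix_norm_le:
  fixes A :: "complex^'n^'r" and blk :: "'r \<Rightarrow> nat"
  assumes "0 < \<gamma>"
  defines "T \<equiv> mat 1 - cadj A ** Mgam blk A \<gamma> ** A" and "C \<equiv> cadj A ** Mgam blk A \<gamma>"
    and "c \<equiv> sqrt (1 - (sigma_gam blk A \<gamma>)\<^sup>2)"
  shows "cmat_norm (iter_matrix T C k) \<le> (1 - c ^ k) / (1 - c) * cmat_norm C"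
proof (cases "A = 0")
  case True
  then have "C = 0"
    by (simp add: C_def vec_eq_iff matrix_matrix_mult_def)
  then show ?thesis
    by simp
next
  case False
  have "0 \<le> c" "c < 1"
    using iteration_contraction(1,2)[OF assms(1) False, of blk] by (simp_all add: c_def power_le_one)
  then have geometric: "(\<Sum>j<k. c^j) = (1 - c ^ k) / (1 - c)"
    by (simp add: sum_gp_strict)
  have "0 \<le> (\<Sum>j<k. c^j)"
    using \<open>0 \<le> c\<close> by (simp add: sum_nonneg)
  have "subspace (range (\<lambda>y. cadj A *v y))"
    by (rule linear_subspace_image[OF matrix_vector_mul_linear subspace_UNIV])
  moreover have "C *v d \<in> range (\<lambda>y. cadj A *v y)" for d
    by (simp add: C_def matrix_vector_mul_assoc[symmetric])
  ultimately have bound: "norm (iter_matrix T C k *v d) \<le> (\<Sum>j<k. c^j) * norm (C *v d)" for d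
    using iter_matrix_bound[OF _ \<open>0 \<le> c\<close>] iteration_contraction_on_range[OF assms(1) False]
    unfolding T_def c_def by blast
  show ?thesis
  proof (rule cmat_norm_le)
    show "0 \<le> (1 - c ^ k) / (1 - c) * cmat_norm C"
      using \<open>0 \<le> (\<Sum>j<k. c^j)\<close> by (intro mult_nonneg_nonneg cmat_norm_nonneg) (simp add: geometric)
    fix d
    have "norm (iter_matrix T C k *v d) \<le> (\<Sum>j<k. c^j) * (cmat_norm C * norm d)"
      using bound[of d] mult_left_mono[OF cmat_norm_bound \<open>0 \<le> (\<Sum>j<k. c^j)\<close>] by (rule order.trans)
    then show "norm (iter_matrix T C k *v d) \<le> (1 - c ^ k) / (1 - c) * cmat_norm C * norm d"
      by (simp add: geometric mult.assoc)
  qed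
qed

text \<open>Neither full row rank nor \<open>k \<ge> 1\<close> is needed: for \<open>A \<noteq> 0\<close> the contraction argument applies,
  and for \<open>A = 0\<close> the error vanishes while \<open>\<sigma>\<^sub>\<gamma>\<close> is the junk value \<open>Inf {}\<close>.\<close>

theorem corollary3p4:
  fixes A :: "complex^'n^'r" and blk :: "'r \<Rightarrow> nat" and \<gamma> :: real
    and p :: "complex^'r" and \<Theta> :: "complex^'r^'r"
    and P :: "nat \<Rightarrow> 'a measure" and pt :: "nat \<Rightarrow> 'a \<Rightarrow> complex^'r" and k :: nat
  assumes "\<gamma> > 0"
    and "rank A = CARD('r)"
    and "\<exists>\<mu>0. centered_gaussian \<mu>0 \<Theta> \<and>
           conv_in_distr P (\<lambda>N \<omega>. sqrt (real N) *\<^sub>R (pt N \<omega> - p)) \<mu>0"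
    and "k \<ge> 1"
  shows "\<exists>\<Lambda> \<mu>. centered_gaussian \<mu> \<Lambda> \<and>
           conv_in_distr P (\<lambda>N \<omega>. sqrt (real N) *\<^sub>R
               (qiter A (Mgam blk A \<gamma>) (pt N \<omega>) k - qiter A (Mgam blk A \<gamma>) p k)) \<mu> \<and>
           cmat_norm \<Lambda> \<le>
             ((1 - sqrt (1 - (sigma_gam blk A \<gamma>)\<^sup>2) ^ k) / (1 - sqrt (1 - (sigma_gam blk A \<gamma>)\<^sup>2)))\<^sup>2
             * (cmat_norm (cadj A ** Mgam blk A \<gamma>))\<^sup>2 * cmat_norm \<Theta>"
proof -
  obtain \<mu>0 where gauss: "centered_gaussian \<mu>0 \<Theta>"
    and conv: "conv_in_distr P (\<lambda>N \<omega>. sqrt (real N) *\<^sub>R (pt N \<omega> - p)) \<mu>0"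
    using assms(3) by blast
  define B where "B = iter_matrix (mat 1 - cadj A ** Mgam blk A \<gamma> ** A) (cadj A ** Mgam blk A \<gamma>) k"
  have error: "sqrt (real N) *\<^sub>R (qiter A (Mgam blk A \<gamma>) (pt N \<omega>) k - qiter A (Mgam blk A \<gamma>) p k) =
      B *v (sqrt (real N) *\<^sub>R (pt N \<omega> - p))" for N \<omega>
    by (simp add: qiter_iter_matrix B_def matrix_vector_mult_diff_distrib cmatrix_vector_mult_scaleR)
  have "cmat_norm (B ** \<Theta> ** cadj B) \<le> (cmat_norm B)\<^sup>2 * cmat_norm \<Theta>"
    by (rule cmat_norm_congruence)
  also have "\<dots> \<le> ((1 - sqrt (1 - (sigma_gam blk A \<gamma>)\<^sup>2) ^ k) / (1 - sqrt (1 - (sigma_gam blk A \<gamma>)\<^sup>2))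
      * cmat_norm (cadj A ** Mgam blk A \<gamma>))\<^sup>2 * cmat_norm \<Theta>"
    unfolding B_def
    by (intro mult_right_mono power_mono block_iter_matrix_norm_le assms(1) cmat_norm_nonneg)
  finally have "cmat_norm (B ** \<Theta> ** cadj B) \<le>
      ((1 - sqrt (1 - (sigma_gam blk A \<gamma>)\<^sup>2) ^ k) / (1 - sqrt (1 - (sigma_gam blk A \<gamma>)\<^sup>2)))\<^sup>2
      * (cmat_norm (cadj A ** Mgam blk A \<gamma>))\<^sup>2 * cmat_norm \<Theta>"
    by (simp only: power_mult_distrib)
  then show ?thesis
    using centered_gaussian_matrix_image[OF gauss, of B] conv_in_distr_matrix_image[OF conv, of B]
    unfolding error by blast
qed

end
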